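(* Let $\lambda>0$ and $\Omega_\lambda=\{x\in\mathbb{R}^2:\ \|x\|<1/\lambda\}$. Let $P=(a,b)\in\Omega_\lambda$, let $s=\{(x,y)\in\mathbb{R}^2:\ y=mx+c\}$ (with $m,c\in\mathbb{R}$) be a line that meets $\Omega_\lambda$, and let $\theta=\arctan m$. Put $$r=\frac{1-\lambda^2c\cos\theta\,(b\cos\theta-a\sin\theta)+\lambda\,|c\cos\theta-b\cos\theta+a\sin\theta|}{1-\lambda^2c^2\cos^2\theta}.$$ Then the $\lambda$-Funk distance from the point $P$ to the line $s$ is $$d_F(P,s)=\frac{\ln r}{\lambda},$$ and this distance is realized by the point $$Q^*=\begin{pmatrix}\cos\theta&-\sin\theta\\ \sin\theta&\cos\theta\end{pmatrix}\begin{pmatrix}\frac{a}{r}\cos\theta+\frac{b}{r}\sin\theta\\ c\cos\theta\end{pmatrix}.$$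
   Context: $\langle\cdot,\cdot\rangle$ and $\|\cdot\|$ denote the usual Euclidean inner product and norm on $\mathbb{R}^2$. For $\lambda>0$ the $\lambda$-Funk metric is the function $F:\Omega_\lambda\times\mathbb{R}^2\to\mathbb{R}$, $$F(x,y)=\frac{\sqrt{\lambda^2\langle x,y\rangle^2+\|y\|^2(1-\lambda^2\|x\|^2)}}{1-\lambda^2\|x\|^2}+\frac{\lambda\langle x,y\rangle}{1-\lambda^2\|x\|^2}.$$ For a piecewise regular curve $\gamma:[\alpha,\beta]\to\Omega_\lambda$, its Finsler arc length is $\mathscr{L}_F(\gamma)=\int_\alpha^\beta F(\gamma(t),\gamma'(t))\,dt$. The induced distance from $P$ to $Q$ is $d_F(P,Q)=\inf_\gamma\mathscr{L}_F(\gamma)$, the infimum being taken over all piecewise regular curves $\gamma:[\alpha,\beta]\to\Omega_\lambda$ with $\gamma(\alpha)=P$ and $\gamma(\beta)=Q$; by convention $d_F(P,P)=0$. Note that $d_F$ need not be symmetric. The distance from a point $P\in\Omega_\lambda$ to a line $s$ is $d_F(P,s):=\min\{d_F(P,P'):\ P'\in s\}$, where $P'$ ranges over the points of $s$ lying in $\Omega_\lambda$ (where $d_F$ is defined). A point $Q^*\in s$ (in $\Omega_\lambda$) realizes the distance from $P$ to $s$ if $d_F(P,Q^* )\le d_F(P,P')$ for all such $P'\in s$. *)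

theory Defs
  imports "HOL-Analysis.Analysis"
begin

definition funk_domain :: "real \<Rightarrow> (real^2) set" where
  "funk_domain lam = {x. norm x < 1 / lam}"

text \<open>Only meaningful for \<open>x\<close> in \<open>funk_domain lam\<close>.\<close>

definition funk_metric :: "real \<Rightarrow> real^2 \<Rightarrow> real^2 \<Rightarrow> real" where
  "funk_metric lam x y =
     sqrt (lam^2 * (x \<bullet> y)^2 + (norm y)^2 * (1 - lam^2 * (norm x)^2)) / (1 - lam^2 * (norm x)^2)
     + lam * (x \<bullet> y) / (1 - lam^2 * (norm x)^2)"

text \<open>A regular curve is \<open>C\<^sup>1\<close> on the closed interval, with one-sided derivatives at the end
  points, and has nowhere vanishing derivative. The library's
  \<open>piecewise_C1_differentiable_on\<close> is not used: it imposes no condition on the one-sided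
  derivatives at the break points, so the speed may be unbounded there.\<close>

definition regular_curve_on :: "(real \<Rightarrow> 'a::real_normed_vector) \<Rightarrow> real \<Rightarrow> real \<Rightarrow> bool" where
  "regular_curve_on g u v \<longleftrightarrow>
     u < v \<and>
     (\<exists>g'. continuous_on {u..v} g' \<and>
           (\<forall>t\<in>{u..v}. (g has_vector_derivative g' t) (at t within {u..v}) \<and> g' t \<noteq> 0))"

definition piecewise_regular_curve_on ::
    "(real \<Rightarrow> 'a::real_normed_vector) \<Rightarrow> real \<Rightarrow> real \<Rightarrow> bool" where
  "piecewise_regular_curve_on g \<alpha> \<beta> \<longleftrightarrow>
     \<alpha> < \<beta> \<and>
     (\<exists>(n::nat) p. p 0 = \<alpha> \<and> p n = \<beta> \<and> (\<forall>i<n. regular_curve_on g (p i) (p (Suc i))))"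

text \<open>At the finitely many break points \<open>vector_derivative\<close> may be an arbitrary value; this does
  not affect the integral.\<close>

definition funk_length :: "real \<Rightarrow> (real \<Rightarrow> real^2) \<Rightarrow> real \<Rightarrow> real \<Rightarrow> real" where
  "funk_length lam g \<alpha> \<beta> =
     integral {\<alpha>..\<beta>} (\<lambda>t. funk_metric lam (g t) (vector_derivative g (at t within {\<alpha>..\<beta>})))"

definition funk_dist :: "real \<Rightarrow> real^2 \<Rightarrow> real^2 \<Rightarrow> real" where
  "funk_dist lam P Q =
     (if P = Q then 0
      else Inf {funk_length lam g \<alpha> \<beta> | g \<alpha> \<beta>.
                  piecewise_regular_curve_on g \<alpha> \<beta> \<and> g ` {\<alpha>..\<beta>} \<subseteq> funk_domain lam \<and>
                  g \<alpha> = P \<and> g \<beta> = Q})"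

text \<open>\<open>Min\<close> is reserved for finite sets, so the minimum is expressed by \<open>LEAST\<close>. It is meaningful
  only if the minimum is attained, i.e. if some point realizes the distance.\<close>

definition funk_dist_to_set :: "real \<Rightarrow> real^2 \<Rightarrow> (real^2) set \<Rightarrow> real" where
  "funk_dist_to_set lam P s = (LEAST d. d \<in> funk_dist lam P ` (s \<inter> funk_domain lam))"

definition realizes_funk_dist :: "real \<Rightarrow> real^2 \<Rightarrow> (real^2) set \<Rightarrow> real^2 \<Rightarrow> bool" where
  "realizes_funk_dist lam P s Q \<longleftrightarrow>
     Q \<in> s \<inter> funk_domain lam \<and>
     (\<forall>P'\<in>s \<inter> funk_domain lam. funk_dist lam P Q \<le> funk_dist lam P P')"

end

theory Submission
  imports Defs
begin

text \<open>
  Write \<open>F = funk_metric lam\<close>. For a nonzero vector \<open>y\<close> at a point \<open>x\<close> of the disc \<open>\<Omega>\<close> of radius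
  \<open>1 / lam\<close>, the number \<open>F x y\<close> is the one for which \<open>x + y / (lam * F x y)\<close> is the point where
  the ray from \<open>x\<close> in direction \<open>y\<close> leaves \<open>\<Omega>\<close>; equivalently, it is the nonnegative solution \<open>f\<close>
  of \<open>norm (y + lam * f * x) = f\<close>. All estimates use this description, not the square root formula
  (\<open>funk_metric_nonneg_and_fixpoint\<close>, \<open>funk_metric_eqI\<close>).

  For a unit vector \<open>u\<close>, the disc lies on one side of its tangent line \<open>u \<bullet> z = 1 / lam\<close>, so the
  exit point does too. This says that \<open>F x y\<close> is at least
  \<open>(u \<bullet> y) / (1 - lam * (u \<bullet> x))\<close>, the differential at \<open>x\<close>, applied to \<open>y\<close>, of the function
  \<open>h = - ln (1 - lam * (u \<bullet> x)) / lam\<close>. Thus \<open>h\<close> is a calibration: every curve from \<open>P\<close> to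
  \<open>P'\<close> has length at least \<open>h P' - h P\<close> (\<open>funk_dist_ge\<close>). Equality holds on a segment that is
  directed at the point of tangency \<open>u / lam\<close> (\<open>funk_dist_along_ray\<close>).

  To find the distance from \<open>P\<close> to a line, let \<open>u\<close> be the unit normal of the line that points
  from the side of \<open>P\<close> to the line. Then \<open>h\<close> is constant on the line, so the same lower
  bound holds for all of its points, and it is attained where the segment from \<open>P\<close> to \<open>u / lam\<close>
  crosses the line (\<open>funk_dist_to_level_line\<close>). The two signs of \<open>u\<close> account for the absolute
  value in \<open>r\<close>.
\<close>

section \<open>The Funk norm as a root of a quadratic equation\<close>

lemma one_minus_norm_sq_pos:
  assumes "lam > 0" "x \<in> funk_domain lam"
  shows "0 < 1 - lam^2 * (norm x)^2"
proof -
  have "lam * norm x < 1"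
    using assms by (simp add: funk_domain_def field_simps)
  then have "(lam * norm x)^2 < 1"
    using assms(1) by (subst power_less_one_iff) auto
  then show ?thesis by (simp add: power_mult_distrib)
qed

lemma norm_add_scaled_sq:
  fixes x y :: "'a::real_inner"
  shows "(norm (y + (lam * f) *\<^sub>R x))^2 = (norm y)^2 + 2 * lam * f * (x \<bullet> y) + lam^2 * f^2 * (norm x)^2"
  by (simp only: power2_norm_eq_inner)
    (simp add: inner_add_left inner_add_right inner_commute power2_eq_square algebra_simps)

text \<open>
  Squaring \<open>norm (y + lam * f * x) = f\<close> gives a quadratic equation for \<open>f\<close> with leading
  coefficient \<open>D = 1 - lam\<^sup>2 * (norm x)\<^sup>2 > 0\<close> and constant term \<open>- (norm y)\<^sup>2 \<le> 0\<close>. Its larger root is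
  the Funk metric.
\<close>

lemma funk_metric_nonneg_and_fixpoint:
  assumes "lam > 0" "x \<in> funk_domain lam"
  shows "0 \<le> funk_metric lam x y"
    and "norm (y + (lam * funk_metric lam x y) *\<^sub>R x) = funk_metric lam x y"
proof -
  define D where "D = 1 - lam^2 * (norm x)^2"
  have D: "D > 0" using one_minus_norm_sq_pos[OF assms] by (simp add: D_def)
  define w where "w = lam * (x \<bullet> y)"
  define S where "S = sqrt (w^2 + (norm y)^2 * D)"
  define F where "F = funk_metric lam x y"
  have F: "F = (S + w) / D"
    by (simp add: F_def funk_metric_def S_def w_def D_def power_mult_distrib add_divide_distrib)
  have S2: "S^2 = w^2 + (norm y)^2 * D"
    unfolding S_def using D by simp
  have "\<bar>w\<bar> \<le> S"
    unfolding S_def by (rule real_le_rsqrt) (use D in simp)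
  then have F0: "0 \<le> F" using D by (simp add: F)
  then show "0 \<le> funk_metric lam x y" by (simp add: F_def)
  have "D * F = S + w" using D by (simp add: F)
  then have "(D * F - w)^2 = w^2 + (norm y)^2 * D" using S2 by simp
  then have "D * (D * F^2 - 2 * w * F - (norm y)^2) = 0"
    by (simp add: power2_eq_square algebra_simps)
  then have "D * F^2 - 2 * w * F - (norm y)^2 = 0" using D by simp
  then have "(norm (y + (lam * F) *\<^sub>R x))^2 = F^2"
    unfolding norm_add_scaled_sq by (simp add: D_def w_def algebra_simps)
  then show "norm (y + (lam * funk_metric lam x y) *\<^sub>R x) = funk_metric lam x y"
    using F0 by (simp add: F_def)
qed

text \<open>
  The product of the roots of the quadratic equation is at most \<open>0\<close>, so that a positive root is
  the larger one.
\<close>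

lemma funk_metric_eqI:
  assumes "lam > 0" "x \<in> funk_domain lam" "0 < f" "norm (y + (lam * f) *\<^sub>R x) = f"
  shows "funk_metric lam x y = f"
proof -
  define D where "D = 1 - lam^2 * (norm x)^2"
  have D: "D > 0" using one_minus_norm_sq_pos[OF assms(1,2)] by (simp add: D_def)
  define w where "w = lam * (x \<bullet> y)"
  have "(norm (y + (lam * f) *\<^sub>R x))^2 = f^2" using assms(4) by simp
  then have q: "D * f^2 = 2 * w * f + (norm y)^2"
    unfolding norm_add_scaled_sq by (simp add: D_def w_def algebra_simps)
  have sq: "w^2 + (norm y)^2 * D = (D * f - w)^2"
  proof -
    have y: "(norm y)^2 = D * f^2 - 2 * w * f" using q by simp
    show ?thesis unfolding y by (simp add: power2_eq_square algebra_simps)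
  qed
  have "w \<le> D * f"
  proof (cases "w \<le> 0")
    case True
    have "0 \<le> D * f" using D assms(3) by simp
    then show ?thesis using True by linarith
  next
    case False
    have "(w + w) * f \<le> (D * f) * f"
      using q zero_le_power2[of "norm y"] by (simp add: power2_eq_square algebra_simps)
    then have "w + w \<le> D * f" using assms(3) by simp
    then show ?thesis using False by linarith
  qed
  then have "sqrt (w^2 + (norm y)^2 * D) = D * f - w"
    unfolding sq by simp
  then have "funk_metric lam x y = (D * f - w) / D + w / D"
    by (simp add: funk_metric_def w_def D_def power_mult_distrib)
  then show ?thesis using D by (simp add: add_divide_distrib[symmetric])
qed

section \<open>Calibration by supporting lines\<close>

lemma one_minus_inner_unit_pos:
  assumes "lam > 0" "x \<in> funk_domain lam" "norm u = 1"
  shows "0 < 1 - lam * (u \<bullet> x)"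
proof -
  have "u \<bullet> x \<le> norm x" using norm_cauchy_schwarz[of u x] assms(3) by simp
  also have "\<dots> < 1 / lam" using assms(2) by (simp add: funk_domain_def)
  finally show ?thesis using assms(1) by (simp add: field_simps)
qed

text \<open>
  By Cauchy-Schwarz, the vector \<open>y + lam * F * x\<close>, whose norm is \<open>F\<close>, has inner product at most
  \<open>F\<close> with \<open>u\<close>.
\<close>

lemma calibration_le_funk_metric:
  assumes "lam > 0" "x \<in> funk_domain lam" "norm u = 1"
  shows "(u \<bullet> y) / (1 - lam * (u \<bullet> x)) \<le> funk_metric lam x y"
proof -
  let ?F = "funk_metric lam x y"
  have "u \<bullet> (y + (lam * ?F) *\<^sub>R x) \<le> norm (y + (lam * ?F) *\<^sub>R x)"
    using norm_cauchy_schwarz[of u] assms(3) by (metis mult_1)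
  also have "\<dots> = ?F" by (rule funk_metric_nonneg_and_fixpoint[OF assms(1,2)])
  finally have "u \<bullet> y \<le> ?F * (1 - lam * (u \<bullet> x))"
    by (simp add: inner_add_right algebra_simps)
  then show ?thesis using one_minus_inner_unit_pos[OF assms] by (simp add: pos_divide_le_eq)
qed

lemma continuous_on_funk_metric:
  assumes "lam > 0" "continuous_on T g" "continuous_on T h" "g ` T \<subseteq> funk_domain lam"
  shows "continuous_on T (\<lambda>t. funk_metric lam (g t) (h t))"
proof -
  have "\<forall>t\<in>T. 1 - lam^2 * (norm (g t))^2 \<noteq> 0"
    using one_minus_norm_sq_pos[OF assms(1)] assms(4) by force
  then show ?thesis unfolding funk_metric_def
    by (intro continuous_intros assms) auto
qed

text \<open>
  The integral on an arc is asserted to exist, as the pieces of a curve are to be added up; the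
  integral of a nonintegrable speed would be \<open>0\<close> by convention, and no bound would follow. The interval
  \<open>{\<alpha>..\<beta>}\<close> is the domain of the whole curve, relative to which the length takes derivatives.
  It matters only at the two ends of the arc, where the curve may have a corner.
\<close>

lemma regular_arc_length_ge:
  assumes lam: "lam > 0" and u: "norm u = 1"
    and reg: "regular_curve_on g v w" and dom: "g ` {v..w} \<subseteq> funk_domain lam"
    and sub: "{v..w} \<subseteq> {\<alpha>..\<beta>}"
  obtains I where
    "((\<lambda>t. funk_metric lam (g t) (vector_derivative g (at t within {\<alpha>..\<beta>}))) has_integral I) {v..w}"
    "- ln (1 - lam * (u \<bullet> g w)) / lam - - ln (1 - lam * (u \<bullet> g v)) / lam \<le> I"
proof -
  from reg obtain g' where vw: "v < w" and cont: "continuous_on {v..w} g'"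
    and der: "\<And>t. t \<in> {v..w} \<Longrightarrow> (g has_vector_derivative g' t) (at t within {v..w})"
    unfolding regular_curve_on_def by blast
  have cg: "continuous_on {v..w} g"
    using der has_vector_derivative_continuous continuous_on_eq_continuous_within by blast
  have "(\<lambda>t. funk_metric lam (g t) (g' t)) integrable_on {v..w}"
    by (intro integrable_continuous_real continuous_on_funk_metric lam cg cont dom)
  then obtain I where I: "((\<lambda>t. funk_metric lam (g t) (g' t)) has_integral I) {v..w}"
    by blast
  let ?h = "\<lambda>t. - ln (1 - lam * (u \<bullet> g t)) / lam"
  have "((\<lambda>t. (u \<bullet> g' t) / (1 - lam * (u \<bullet> g t))) has_integral ?h w - ?h v) {v..w}"
  proof (rule fundamental_theorem_of_calculus)
    fix t assume t: "t \<in> {v..w}"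
    have pos: "0 < 1 - lam * (u \<bullet> g t)"
      using one_minus_inner_unit_pos[OF lam _ u] dom t by blast
    have "((\<lambda>t. u \<bullet> g t) has_real_derivative u \<bullet> g' t) (at t within {v..w})"
      using bounded_linear.has_vector_derivative[OF bounded_linear_inner_right der[OF t]]
      by (simp add: has_real_derivative_iff_has_vector_derivative)
    then have "(?h has_real_derivative (u \<bullet> g' t) / (1 - lam * (u \<bullet> g t))) (at t within {v..w})"
      using pos lam by (auto intro!: derivative_eq_intros simp: divide_simps)
    then show "(?h has_vector_derivative (u \<bullet> g' t) / (1 - lam * (u \<bullet> g t))) (at t within {v..w})"
      by (simp add: has_real_derivative_iff_has_vector_derivative)
  qed (use vw in simp)
  then have le: "?h w - ?h v \<le> I"
    using I by (rule has_integral_le) (use calibration_le_funk_metric[OF lam _ u] dom in blast)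
  have "((\<lambda>t. funk_metric lam (g t) (vector_derivative g (at t within {\<alpha>..\<beta>}))) has_integral I) {v..w}"
  proof (rule has_integral_spike_finite[OF _ _ I])
    fix t assume "t \<in> {v..w} - {v, w}"
    then have t: "v < t" "t < w" by auto
    then have tab: "\<alpha> < t" "t < \<beta>" using sub vw by auto
    have "(g has_vector_derivative g' t) (at t)"
      using der[of t] t at_within_Icc_at[of v t w] by simp
    then have "vector_derivative g (at t within {\<alpha>..\<beta>}) = g' t"
      using tab at_within_Icc_at[of \<alpha> t \<beta>] by (simp add: vector_derivative_at)
    then show "funk_metric lam (g t) (vector_derivative g (at t within {\<alpha>..\<beta>})) =
        funk_metric lam (g t) (g' t)" by simp
  qed simp
  then show thesis using le by (rule that)
qed

lemma funk_length_ge: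
  assumes lam: "lam > 0" and u: "norm u = 1"
    and pw: "piecewise_regular_curve_on g \<alpha> \<beta>" and dom: "g ` {\<alpha>..\<beta>} \<subseteq> funk_domain lam"
  shows "ln ((1 - lam * (u \<bullet> g \<alpha>)) / (1 - lam * (u \<bullet> g \<beta>))) / lam \<le> funk_length lam g \<alpha> \<beta>"
proof -
  let ?f = "\<lambda>t. funk_metric lam (g t) (vector_derivative g (at t within {\<alpha>..\<beta>}))"
  let ?h = "\<lambda>t. - ln (1 - lam * (u \<bullet> g t)) / lam"
  from pw obtain n p where ab: "\<alpha> < \<beta>" and p0: "p 0 = \<alpha>" and pn: "p n = \<beta>"
    and reg: "\<And>i. i < n \<Longrightarrow> regular_curve_on g (p i) (p (Suc i))"
    unfolding piecewise_regular_curve_on_def by blast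
  have step: "p i \<le> p (Suc i)" if "i < n" for i
    using reg[OF that] by (simp add: regular_curve_on_def)
  have low: "\<alpha> \<le> p j" if "j \<le> n" for j
    using that by (induction j) (use p0 step in \<open>auto intro: order_trans simp: Suc_le_eq\<close>)
  have high: "p j \<le> \<beta>" if "j \<le> n" for j
    using that by (induction rule: inc_induct) (use pn step in \<open>auto intro: order_trans\<close>)
  have "\<exists>I. (?f has_integral I) {\<alpha>..p j} \<and> ?h (p j) - ?h \<alpha> \<le> I" if "j \<le> n" for j
    using that
  proof (induction j)
    case 0
    show ?case using has_integral_refl(2)[of ?f \<alpha>] by (intro exI[of _ 0]) (simp add: p0)
  next
    case (Suc j)
    then have j: "j < n" by simp
    from Suc obtain I where I: "(?f has_integral I) {\<alpha>..p j}" "?h (p j) - ?h \<alpha> \<le> I" by auto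
    have sub: "{p j..p (Suc j)} \<subseteq> {\<alpha>..\<beta>}"
      using low[of j] high[of "Suc j"] j by auto
    have "g ` {p j..p (Suc j)} \<subseteq> funk_domain lam"
      using dom sub by blast
    then obtain J where J: "(?f has_integral J) {p j..p (Suc j)}" "?h (p (Suc j)) - ?h (p j) \<le> J"
      by (rule regular_arc_length_ge[OF lam u reg[OF j] _ sub])
    have "(?f has_integral I + J) {\<alpha>..p (Suc j)}"
      using has_integral_combine[OF _ _ I(1) J(1)] low[of j] step j by simp
    moreover have "?h (p (Suc j)) - ?h \<alpha> \<le> I + J" using I(2) J(2) by linarith
    ultimately show ?case by blast
  qed
  from this[of n] obtain I where I: "(?f has_integral I) {\<alpha>..\<beta>}" "?h \<beta> - ?h \<alpha> \<le> I"
    using pn by auto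
  have pos: "0 < 1 - lam * (u \<bullet> g \<alpha>)" "0 < 1 - lam * (u \<bullet> g \<beta>)"
    by (rule one_minus_inner_unit_pos[OF lam _ u]; use dom ab in force)+
  have "ln ((1 - lam * (u \<bullet> g \<alpha>)) / (1 - lam * (u \<bullet> g \<beta>))) / lam = ?h \<beta> - ?h \<alpha>"
    by (subst ln_div) (use pos in \<open>simp add: diff_divide_distrib\<close>)
  then show ?thesis using I unfolding funk_length_def by (simp add: integral_unique)
qed

section \<open>Bounds for the Funk distance\<close>

lemma regular_curve_imp_piecewise:
  assumes "regular_curve_on g v w"
  shows "piecewise_regular_curve_on g v w"
  unfolding piecewise_regular_curve_on_def
proof (intro conjI exI)
  show "v < w" using assms by (simp add: regular_curve_on_def)
  let ?p = "\<lambda>i::nat. if i = 0 then v else w"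
  show "?p 0 = v" "?p 1 = w" "\<forall>i<1. regular_curve_on g (?p i) (?p (Suc i))"
    using assms by auto
qed

lemma linepath_joins_in_funk_domain:
  assumes "P \<noteq> Q" "P \<in> funk_domain lam" "Q \<in> funk_domain lam"
  shows "piecewise_regular_curve_on (linepath P Q) 0 1"
    and "linepath P Q ` {0..1} \<subseteq> funk_domain lam"
proof -
  have "regular_curve_on (linepath P Q) 0 1"
    unfolding regular_curve_on_def
    by (intro conjI exI[of _ "\<lambda>_. Q - P"])
      (use assms(1) in \<open>auto intro: has_vector_derivative_linepath_within\<close>)
  then show "piecewise_regular_curve_on (linepath P Q) 0 1"
    by (rule regular_curve_imp_piecewise)
  have "funk_domain lam = ball 0 (1 / lam)" by (auto simp: funk_domain_def)
  then have "closed_segment P Q \<subseteq> funk_domain lam"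
    using assms(2,3) by (simp add: closed_segment_subset)
  then show "linepath P Q ` {0..1} \<subseteq> funk_domain lam"
    by (simp add: linepath_image_01)
qed

text \<open>
  The segment from \<open>P\<close> to \<open>Q\<close> serves to make the set of lengths nonempty: the lower bound passes
  to the infimum only then.
\<close>

lemma funk_dist_ge:
  assumes lam: "lam > 0" and u: "norm u = 1"
    and P: "P \<in> funk_domain lam" and Q: "Q \<in> funk_domain lam"
  shows "ln ((1 - lam * (u \<bullet> P)) / (1 - lam * (u \<bullet> Q))) / lam \<le> funk_dist lam P Q"
proof (cases "P = Q")
  case True
  then show ?thesis using one_minus_inner_unit_pos[OF lam Q u] by (simp add: funk_dist_def)
next
  case False
  have "ln ((1 - lam * (u \<bullet> P)) / (1 - lam * (u \<bullet> Q))) / lam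
    \<le> Inf {funk_length lam g \<alpha> \<beta> | g \<alpha> \<beta>.
          piecewise_regular_curve_on g \<alpha> \<beta> \<and> g ` {\<alpha>..\<beta>} \<subseteq> funk_domain lam \<and>
          g \<alpha> = P \<and> g \<beta> = Q}"
  proof (rule cInf_greatest)
    have "linepath P Q 0 = P" "linepath P Q 1 = Q" by (simp_all add: linepath_def)
    then show "{funk_length lam g \<alpha> \<beta> | g \<alpha> \<beta>.
          piecewise_regular_curve_on g \<alpha> \<beta> \<and> g ` {\<alpha>..\<beta>} \<subseteq> funk_domain lam \<and>
          g \<alpha> = P \<and> g \<beta> = Q} \<noteq> {}"
      using linepath_joins_in_funk_domain[OF False P Q] by blast
  qed (use funk_length_ge[OF lam u] in blast)
  then show ?thesis using False by (simp add: funk_dist_def)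
qed

lemma funk_dist_le:
  assumes lam: "lam > 0" and "P \<noteq> Q" and pw: "piecewise_regular_curve_on g \<alpha> \<beta>"
    and dom: "g ` {\<alpha>..\<beta>} \<subseteq> funk_domain lam" and "g \<alpha> = P" "g \<beta> = Q"
  shows "funk_dist lam P Q \<le> funk_length lam g \<alpha> \<beta>"
proof -
  \<comment> \<open>Any direction gives a lower bound for the set of lengths.\<close>
  obtain u :: "real^2" where u: "norm u = 1"
    using vector_choose_size[of 1] by auto
  let ?L = "{funk_length lam g \<alpha> \<beta> | g \<alpha> \<beta>.
          piecewise_regular_curve_on g \<alpha> \<beta> \<and> g ` {\<alpha>..\<beta>} \<subseteq> funk_domain lam \<and>
          g \<alpha> = P \<and> g \<beta> = Q}"
  have "bdd_below ?L"
    by (rule bdd_belowI[of _ "ln ((1 - lam * (u \<bullet> P)) / (1 - lam * (u \<bullet> Q))) / lam"])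
      (use funk_length_ge[OF lam u] in blast)
  then have "Inf ?L \<le> funk_length lam g \<alpha> \<beta>"
    by (rule cInf_lower[rotated]) (use assms in blast)
  then show ?thesis using assms(2) by (simp add: funk_dist_def)
qed

text \<open>
  The segment from \<open>P\<close> towards the boundary point \<open>u / lam\<close>, in the parametrization in which the
  remaining distance decays like \<open>exp (- lam * t)\<close>: this is the one with unit Funk speed.
\<close>

definition funk_ray :: "real \<Rightarrow> 'a::real_vector \<Rightarrow> 'a \<Rightarrow> real \<Rightarrow> 'a" where
  "funk_ray lam u P t = (1 / lam) *\<^sub>R u + exp (- lam * t) *\<^sub>R (P - (1 / lam) *\<^sub>R u)"

lemma funk_ray_in_domain:
  assumes "lam > 0" "norm u = 1" "P \<in> funk_domain lam" "0 \<le> t"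
  shows "funk_ray lam u P t \<in> funk_domain lam"
proof -
  let ?e = "exp (- lam * t)"
  have e: "0 < ?e" "?e \<le> 1" using assms by auto
  have "funk_ray lam u P t = ((1 - ?e) / lam) *\<^sub>R u + ?e *\<^sub>R P"
    by (simp add: funk_ray_def algebra_simps diff_divide_distrib)
  also have "norm \<dots> \<le> norm (((1 - ?e) / lam) *\<^sub>R u) + norm (?e *\<^sub>R P)"
    by (rule norm_triangle_ineq)
  also have "\<dots> = (1 - ?e) / lam + ?e * norm P"
    using assms e by simp
  also have "\<dots> < (1 - ?e) / lam + ?e * (1 / lam)"
    by (intro add_strict_left_mono mult_strict_left_mono e(1))
      (use assms(3) in \<open>simp add: funk_domain_def\<close>)
  also have "\<dots> = 1 / lam" by (simp add: diff_divide_distrib)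
  finally show ?thesis by (simp add: funk_domain_def)
qed

lemma has_vector_derivative_funk_ray:
  fixes u P :: "'a::real_normed_vector"
  assumes "lam > 0"
  shows "(funk_ray lam u P has_vector_derivative u - lam *\<^sub>R funk_ray lam u P t) (at t within T)"
proof -
  let ?X = "(1 / lam) *\<^sub>R u"
  have "((\<lambda>t. exp (- lam * t)) has_real_derivative - lam * exp (- lam * t)) (at t within T)"
    by (auto intro!: derivative_eq_intros)
  from has_vector_derivative_scaleR[OF this has_vector_derivative_const[of "P - ?X"]]
  have "((\<lambda>t. exp (- lam * t) *\<^sub>R (P - ?X)) has_vector_derivative
      (- lam * exp (- lam * t)) *\<^sub>R (P - ?X)) (at t within T)" by simp
  from has_vector_derivative_add[OF has_vector_derivative_const[of ?X] this]
  show ?thesis using assms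
    by (simp add: funk_ray_def[abs_def] algebra_simps)
qed

text \<open>
  The velocity at \<open>x\<close> is \<open>y = u - lam * x\<close>, so \<open>y + lam * x = u\<close> has norm \<open>1\<close> and the Funk speed
  is \<open>1\<close>. Hence the ray has length \<open>T\<close>, which equals the lower bound given by \<open>u\<close> because
  \<open>1 - lam * (u \<bullet> x)\<close> shrinks by the factor \<open>exp (- lam * T)\<close>.
\<close>

lemma funk_dist_along_ray:
  assumes lam: "lam > 0" and u: "norm u = 1" and P: "P \<in> funk_domain lam" and T: "0 \<le> T"
  shows "funk_dist lam P (funk_ray lam u P T) = T"
proof (cases "T = 0")
  case True
  then show ?thesis by (simp add: funk_dist_def funk_ray_def)
next
  case False
  then have T0: "0 < T" using T by simp
  let ?g = "funk_ray lam u P"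
  let ?Q = "?g T"
  have ends: "?g 0 = P" by (simp add: funk_ray_def)
  have dom: "?g t \<in> funk_domain lam" if "0 \<le> t" for t
    using funk_ray_in_domain[OF lam u P that] .
  have lvl: "1 - lam * (u \<bullet> ?g t) = exp (- lam * t) * (1 - lam * (u \<bullet> P))" for t
    using lam u by (simp add: funk_ray_def inner_add_right inner_diff_right
        power2_norm_eq_inner[symmetric] algebra_simps)
  have posP: "0 < 1 - lam * (u \<bullet> P)" by (rule one_minus_inner_unit_pos[OF lam P u])
  have lower: "T \<le> funk_dist lam P ?Q"
  proof -
    have "(1 - lam * (u \<bullet> P)) / (1 - lam * (u \<bullet> ?Q)) = exp (lam * T)"
      using posP unfolding lvl by (simp add: exp_minus field_simps)
    then show ?thesis
      using funk_dist_ge[OF lam u P dom[OF T]] lam by simp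
  qed
  have speed: "u - lam *\<^sub>R ?g t \<noteq> 0" if "0 \<le> t" for t
  proof
    assume "u - lam *\<^sub>R ?g t = 0"
    then have "u = lam *\<^sub>R ?g t" by simp
    then have "u \<bullet> u = lam * (u \<bullet> ?g t)" by (metis inner_scaleR_right)
    then show False
      using one_minus_inner_unit_pos[OF lam dom[OF that] u] u by (simp add: power2_norm_eq_inner[symmetric])
  qed
  have "regular_curve_on ?g 0 T"
    unfolding regular_curve_on_def
  proof (intro conjI exI ballI)
    show "continuous_on {0..T} (\<lambda>t. u - lam *\<^sub>R ?g t)"
      unfolding funk_ray_def by (intro continuous_intros)
  qed (use T0 speed has_vector_derivative_funk_ray[OF lam] in auto)
  then have pw: "piecewise_regular_curve_on ?g 0 T" by (rule regular_curve_imp_piecewise)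
  have unit: "funk_metric lam (?g t) (vector_derivative ?g (at t within {0..T})) = 1"
    if t: "t \<in> {0..T}" for t
  proof -
    have "vector_derivative ?g (at t within {0..T}) = u - lam *\<^sub>R ?g t"
      using vector_derivative_within_cbox[OF T0 _ has_vector_derivative_funk_ray[OF lam], of t] t
      by simp
    moreover have "funk_metric lam (?g t) (u - lam *\<^sub>R ?g t) = 1"
      by (rule funk_metric_eqI) (use lam dom t u in auto)
    ultimately show ?thesis by simp
  qed
  have "funk_length lam ?g 0 T = integral {0..T} (\<lambda>_. 1)"
    unfolding funk_length_def by (rule Henstock_Kurzweil_Integration.integral_cong) (rule unit)
  then have len: "funk_length lam ?g 0 T = T" using T by simp
  have "P \<noteq> ?Q"
    using lower T0 by (auto simp: funk_dist_def)
  then have "funk_dist lam P ?Q \<le> T"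
    using funk_dist_le[OF lam _ pw] dom ends len by fastforce
  then show ?thesis using lower by simp
qed

section \<open>The distance to a line\<close>

lemma funk_dist_to_set_eqI:
  assumes "realizes_funk_dist lam P s Q"
  shows "funk_dist_to_set lam P s = funk_dist lam P Q"
  unfolding funk_dist_to_set_def
  by (rule Least_equality) (use assms in \<open>auto simp: realizes_funk_dist_def\<close>)

text \<open>
  The lower bound given by \<open>u\<close> depends only on \<open>u \<bullet> x\<close> and is therefore the same for all points
  of the line. The point \<open>Q\<close> is where the ray from \<open>P\<close> to \<open>u / lam\<close> meets the line, at time
  \<open>ln r / lam\<close>. The inequality \<open>1 \<le> r\<close> says that \<open>P\<close> does not lie beyond the line as seen along
  \<open>u\<close>, so that this time is not negative.
\<close>

lemma funk_dist_to_level_line: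
  assumes lam: "lam > 0" and u: "norm u = 1" and P: "P \<in> funk_domain lam"
    and r: "1 \<le> r" "r = (1 - lam * (u \<bullet> P)) / (1 - lam * k)"
    and Q: "Q = (1 / lam) *\<^sub>R u + (1 / r) *\<^sub>R (P - (1 / lam) *\<^sub>R u)"
  shows "funk_dist_to_set lam P {x. u \<bullet> x = k} = ln r / lam"
    and "realizes_funk_dist lam P {x. u \<bullet> x = k} Q"
proof -
  have Qray: "Q = funk_ray lam u P (ln r / lam)"
    using r(1) lam by (simp add: Q funk_ray_def exp_minus inverse_eq_divide)
  have lnr: "0 \<le> ln r / lam" using r(1) lam by simp
  have d: "funk_dist lam P Q = ln r / lam"
    unfolding Qray by (rule funk_dist_along_ray[OF lam u P lnr])
  have "u \<bullet> Q = 1 / lam - (1 - lam * (u \<bullet> P)) / r / lam"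
    using lam u r(1) by (simp add: Q inner_add_right inner_diff_right
        power2_norm_eq_inner[symmetric] field_simps)
  also have "(1 - lam * (u \<bullet> P)) / r = 1 - lam * k"
    using r one_minus_inner_unit_pos[OF lam P u] by simp
  finally have "u \<bullet> Q = k" using lam by (simp add: field_simps)
  moreover have "Q \<in> funk_domain lam"
    unfolding Qray by (rule funk_ray_in_domain[OF lam u P lnr])
  moreover have "ln r / lam \<le> funk_dist lam P P'"
    if "P' \<in> funk_domain lam" "u \<bullet> P' = k" for P'
    using funk_dist_ge[OF lam u P that(1)] by (simp only: that(2) r(2))
  ultimately show *: "realizes_funk_dist lam P {x. u \<bullet> x = k} Q"
    by (simp add: realizes_funk_dist_def d)
  show "funk_dist_to_set lam P {x. u \<bullet> x = k} = ln r / lam"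
    using funk_dist_to_set_eqI[OF *] d by simp
qed

lemma inner_vector_2:
  "(vector [p, q] :: real^2) \<bullet> x = p * x $ 1 + q * x $ 2"
  by (simp add: inner_vec_def sum_2)

lemma unit_normal_of_slope:
  fixes m c :: real
  defines "n \<equiv> vector [- sin (arctan m), cos (arctan m)] :: real^2"
  shows "norm n = 1"
    and "{vector [x, y] | x y. y = m * x + c} = {x. n \<bullet> x = c * cos (arctan m)}"
proof -
  show "norm n = 1"
    by (simp add: n_def norm_eq_1 inner_vector_2 power2_eq_square[symmetric])
  have sc: "sin (arctan m) = m * cos (arctan m)"
    by (simp add: sin_arctan cos_arctan)
  have "n \<bullet> x = c * cos (arctan m) \<longleftrightarrow> x $ 2 = m * x $ 1 + c" for x
  proof -
    have "n \<bullet> x - c * cos (arctan m) = cos (arctan m) * (x $ 2 - (m * x $ 1 + c))"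
      by (simp add: n_def inner_vector_2 sc algebra_simps)
    then show ?thesis using cos_arctan_not_zero[of m]
      by (metis eq_iff_diff_eq_0 mult_eq_0_iff)
  qed
  moreover have "x = vector [x $ 1, x $ 2]" for x :: "real^2"
    by (simp add: vec_eq_iff forall_2)
  ultimately show "{vector [x, y] | x y. y = m * x + c} = {x. n \<bullet> x = c * cos (arctan m)}"
    by (auto simp: vector_2) metis
qed

theorem theorem7:
  fixes lam a b m c \<theta> r :: real and P Q :: "real^2" and s :: "(real^2) set"
  assumes "lam > 0"
    and "P = vector [a, b]" and "P \<in> funk_domain lam"
    and "s = {vector [x, y] | x y. y = m * x + c}" and "s \<inter> funk_domain lam \<noteq> {}"
    and "\<theta> = arctan m"
    and "r = (1 - lam^2 * c * cos \<theta> * (b * cos \<theta> - a * sin \<theta>)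
               + lam * \<bar>c * cos \<theta> - b * cos \<theta> + a * sin \<theta>\<bar>)
             / (1 - lam^2 * c^2 * (cos \<theta>)^2)"
    and "Q = (vector [vector [cos \<theta>, - sin \<theta>], vector [sin \<theta>, cos \<theta>]] :: real^2^2)
             *v vector [a / r * cos \<theta> + b / r * sin \<theta>, c * cos \<theta>]"
  shows "funk_dist_to_set lam P s = ln r / lam \<and> realizes_funk_dist lam P s Q"
proof -
  define n :: "real^2" where "n = vector [- sin \<theta>, cos \<theta>]"
  define k where "k = c * cos \<theta>"
  define p where "p = b * cos \<theta> - a * sin \<theta>"
  \<comment> \<open>The sign that makes \<open>\<sigma> *\<^sub>R n\<close> point from the side of \<open>P\<close> to the line.\<close>
  define \<sigma> :: real where "\<sigma> = (if p \<le> k then 1 else - 1)"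
  have \<sigma>: "\<sigma> = 1 \<or> \<sigma> = - 1" by (auto simp: \<sigma>_def)
  note lam = assms(1) and P = assms(3)
  have n: "norm n = 1" and s: "s = {x. n \<bullet> x = k}"
    using unit_normal_of_slope(1)[of m] unit_normal_of_slope(2)[of m c] by (simp_all add: n_def k_def assms(4,6))
  have u: "norm (\<sigma> *\<^sub>R n) = 1" using n \<sigma> by auto
  have s': "s = {x. (\<sigma> *\<^sub>R n) \<bullet> x = \<sigma> * k}" using \<sigma> by (auto simp: s)
  have nP: "n \<bullet> P = p" by (simp add: n_def assms(2) inner_vector_2 p_def)
  obtain z where z: "z \<in> funk_domain lam" "n \<bullet> z = k" using assms(5) s by auto
  have k: "0 < 1 - lam * k" "0 < 1 + lam * k"
    using one_minus_inner_unit_pos[OF lam z(1) n] one_minus_inner_unit_pos[OF lam z(1), of "- n"] n z(2) by auto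
  have k\<sigma>: "0 < 1 - lam * (\<sigma> * k)" "0 < 1 + lam * (\<sigma> * k)" using k \<sigma> by auto
  have r: "r = (1 - lam * ((\<sigma> *\<^sub>R n) \<bullet> P)) / (1 - lam * (\<sigma> * k))"
  proof -
    have "\<bar>c * cos \<theta> - b * cos \<theta> + a * sin \<theta>\<bar> = \<sigma> * (k - p)"
      by (simp add: \<sigma>_def k_def p_def)
    then have "r = (1 - lam^2 * k * p + lam * (\<sigma> * (k - p))) / (1 - lam^2 * k^2)"
      by (simp add: assms(7) k_def p_def power_mult_distrib mult.assoc)
    \<comment> \<open>The factor \<open>1 + lam * (\<sigma> * k)\<close> cancels from the fraction.\<close>
    also have "1 - lam^2 * k * p + lam * (\<sigma> * (k - p)) = (1 + lam * (\<sigma> * k)) * (1 - lam * (\<sigma> * p))"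
      using \<sigma> by (auto simp: power2_eq_square algebra_simps)
    also have "1 - lam^2 * k^2 = (1 + lam * (\<sigma> * k)) * (1 - lam * (\<sigma> * k))"
      using \<sigma> by (auto simp: power2_eq_square algebra_simps)
    finally show ?thesis using k\<sigma> by (simp add: nP)
  qed
  have "\<sigma> * p \<le> \<sigma> * k" by (simp add: \<sigma>_def)
  then have r1: "1 \<le> r"
    unfolding r using k\<sigma> lam by (simp add: nP)
  \<comment> \<open>Along the normal \<open>n\<close>, the contraction of \<open>P\<close> towards \<open>\<sigma> *\<^sub>R n / lam\<close> by the factor \<open>1 / r\<close>
    ends on the line.\<close>
  have height: "\<sigma> / lam + (p - \<sigma> / lam) / r = k"
  proof -
    have rk: "r * (1 - lam * (\<sigma> * k)) = 1 - lam * (\<sigma> * p)"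
      unfolding r using k\<sigma> by (simp add: nP)
    have "p - \<sigma> / lam = - (\<sigma> / lam) * (r * (1 - lam * (\<sigma> * k)))"
      unfolding rk using lam \<sigma> by (auto simp: field_simps)
    then have "(p - \<sigma> / lam) / r = - (\<sigma> / lam) * (1 - lam * (\<sigma> * k))"
      using r1 by (simp only:) simp
    also have "\<dots> = k - \<sigma> / lam"
      using lam \<sigma> by (auto simp: field_simps)
    finally show ?thesis by simp
  qed
  have Q: "Q = (1 / lam) *\<^sub>R (\<sigma> *\<^sub>R n) + (1 / r) *\<^sub>R (P - (1 / lam) *\<^sub>R (\<sigma> *\<^sub>R n))"
  proof -
    define q where "q = a * cos \<theta> + b * sin \<theta>"
    \<comment> \<open>In the frame turned by \<open>\<theta>\<close>, the point \<open>P\<close> has coordinates \<open>q\<close> and \<open>p\<close>, and the contraction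
      divides \<open>q\<close> by \<open>r\<close>.\<close>
    have a: "a = cos \<theta> * q - sin \<theta> * p"
      using sin_cos_squared_add[of \<theta>] unfolding p_def q_def by algebra
    have b: "b = sin \<theta> * q + cos \<theta> * p"
      using sin_cos_squared_add[of \<theta>] unfolding p_def q_def by algebra
    have "Q $ 1 = cos \<theta> * (q / r) - sin \<theta> * k"
      "Q $ 2 = sin \<theta> * (q / r) + cos \<theta> * k"
      by (simp_all add: assms(8) matrix_vector_mult_def sum_2 k_def q_def add_divide_distrib algebra_simps)
    moreover have "a / r = cos \<theta> * (q / r) - sin \<theta> * (p / r)"
      by (subst a) (simp add: diff_divide_distrib)
    moreover have "b / r = sin \<theta> * (q / r) + cos \<theta> * (p / r)"
      by (subst b) (simp add: add_divide_distrib)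
    ultimately show ?thesis
      unfolding vec_eq_iff forall_2
      by (simp add: n_def assms(2) height[symmetric] diff_divide_distrib algebra_simps)
  qed
  show ?thesis
    using funk_dist_to_level_line[OF lam u P r1 r Q] unfolding s' by blast
qed

end
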